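(* For every integer $n\ge 100$, $\mathrm{wsat}_4(n,B_4)\geq \frac{6}{13}n-\frac{11}{13}$. Moreover, this bound is sharp for $n\equiv 4 \pmod{13}$: for every $n\ge 100$ with $n\equiv 4\pmod{13}$, $\mathrm{wsat}_4(n,B_4)=\frac{6n-11}{13}$.
   Context: A $4$-uniform hypergraph $H$ has a vertex set $V(H)$ and a set $E(H)$ of $4$-element subsets of $V(H)$ (hyperedges). The bow tie $B_4$ is the $4$-uniform hypergraph with $7$ vertices and two hyperedges sharing exactly one vertex; a $4$-uniform hypergraph contains a copy of $B_4$ iff two of its hyperedges intersect in exactly one vertex. A $4$-uniform hypergraph $H$ on $n$ vertices is $B_4$-semi-saturated if for every $4$-subset $e\subseteq V(H)$ with $e\notin E(H)$ there is a hyperedge $f\in E(H)$ with $|e\cap f|=1$ (so adding $e$ creates a new copy of $B_4$); $H$ itself need not be $B_4$-free. $\mathrm{wsat}_4(n,B_4)$ denotes the minimum number of hyperedges of an $n$-vertex $4$-uniform $B_4$-semi-saturated hypergraph. *)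

theory Defs
  imports Complex_Main
begin

definition uniform4 :: "nat \<Rightarrow> nat set set \<Rightarrow> bool" where
  "uniform4 n E \<longleftrightarrow> (\<forall>e\<in>E. e \<subseteq> {..<n} \<and> card e = 4)"

definition B4_semisat :: "nat \<Rightarrow> nat set set \<Rightarrow> bool" where
  "B4_semisat n E \<longleftrightarrow> uniform4 n E \<and>
     (\<forall>e. e \<subseteq> {..<n} \<and> card e = 4 \<and> e \<notin> E \<longrightarrow> (\<exists>f\<in>E. card (e \<inter> f) = 1))"

definition wsat4_B4 :: "nat \<Rightarrow> nat" where
  "wsat4_B4 n = (LEAST k. \<exists>E. B4_semisat n E \<and> card E = k)"

end

theory Submission
  imports Defs
begin

text \<open>
  Lower bound: give every vertex weight one and split it equally among the hyperedges through it.
  A hyperedge without a vertex of degree one receives at most 2. A pendant hyperedge (one with a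
  degree-one vertex) may receive up to 5/2, but its degree-two vertices link it to other hyperedges
  which then have slack: a hyperedge linked to two other pendant ones \<open>f\<close> and \<open>g\<close> would give a
  4-set, made of the two linking vertices and degree-one vertices of \<open>f\<close> and \<open>g\<close>, that meets no
  hyperedge in exactly one vertex. So every hyperedge donates to at most one pendant hyperedge, and
  the average is at most 13/6. Pendant hyperedges containing two vertices of equal star and degree
  at most two escape this argument, but there is at most one of them; its weight is at most 4, and
  4 - 13/6 = 11/6 is the additive constant. Isolated vertices forbid links between pendant
  hyperedges, which lowers the average to 17/8.

  Construction: take a 4-regular graph with half-edges and let its edges and half-edges be the
  vertices and the stars of its nodes the hyperedges. If the graph has no 4-cycle, no triangle
  through a node with a half-edge, and no node with two half-edge neighbours, then every nonempty
  set of at most four vertices that meets no hyperedge in exactly one vertex has exactly three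
  elements, so adding one isolated hyperedge gives a semi-saturated hypergraph.
\<close>

subsection \<open>Lower bound\<close>

locale semisaturated =
  fixes n :: nat and E :: "nat set set"
  assumes semisat: "B4_semisat n E"
begin

section \<open>Stars, pendant hyperedges and donors\<close>

definition star :: "nat \<Rightarrow> nat set set" where
  "star v = {f \<in> E. v \<in> f}"

definition pendant :: "nat set set" where
  "pendant = {f \<in> E. \<exists>p. star p = {f}}"

text \<open>Equal stars mean either a second vertex of degree one or two degree-two vertices linking
  \<open>f\<close> to the same hyperedge; both would spoil the local estimate by donors.\<close>

definition twin_pendant :: "nat set set" where
  "twin_pendant = {f \<in> pendant. \<exists>u\<in>f. \<exists>v\<in>f. u \<noteq> v \<and> star u = star v \<and> card (star u) \<le> 2}"

definition donors :: "nat set \<Rightarrow> nat set set" where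
  "donors f = {h \<in> E - pendant. \<exists>x. star x = {f, h}}"

definition isolated :: "nat set" where
  "isolated = {v. v < n \<and> star v = {}}"

definition weight :: "nat set \<Rightarrow> real" where
  "weight f = (\<Sum>v\<in>f. 1 / card (star v))"

lemma edge_subset: "f \<in> E \<Longrightarrow> f \<subseteq> {..<n}"
  and card_edge: "f \<in> E \<Longrightarrow> card f = 4"
  using semisat by (auto simp: B4_semisat_def uniform4_def)

lemma finite_edge: "f \<in> E \<Longrightarrow> finite f"
  using edge_subset finite_subset by blast

lemma finite_edges: "finite E"
  by (rule finite_subset[of _ "Pow {..<n}"]) (use edge_subset in auto)

lemma finite_star: "finite (star v)"
  using finite_edges by (simp add: star_def)

lemma in_star_iff: "f \<in> star v \<longleftrightarrow> f \<in> E \<and> v \<in> f"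
  by (simp add: star_def)

lemma star_nonempty_less: "star v \<noteq> {} \<Longrightarrow> v < n"
  using edge_subset by (auto simp: star_def)

section \<open>Four-sets meeting no hyperedge in exactly one vertex\<close>

text \<open>This contrapositive is the only form in which the saturation condition enters the lower
  bound.\<close>

lemma tangled_is_edge:
  assumes S: "S \<subseteq> {..<n}" "card S = 4"
    and tangled: "\<And>v f. v \<in> S \<Longrightarrow> f \<in> star v \<Longrightarrow> \<exists>w\<in>S. w \<noteq> v \<and> f \<in> star w"
  shows "S \<in> E"
proof (rule ccontr)
  assume "S \<notin> E"
  then obtain f where f: "f \<in> E" "card (S \<inter> f) = 1"
    using semisat S unfolding B4_semisat_def by blast
  then obtain v where v: "S \<inter> f = {v}"
    by (auto simp: card_1_singleton_iff)
  with f have "v \<in> S" "f \<in> star v"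
    by (auto simp: star_def)
  then obtain w where "w \<in> S" "w \<noteq> v" "f \<in> star w"
    using tangled by blast
  then show False
    using v by (auto simp: star_def)
qed

text \<open>Contradictions come from the four stars: the quadruple cannot lie in two disjoint ones,
  nor in an empty one.\<close>

lemma tangled_quadruple_is_edge:
  assumes "{a, b, c, d} \<subseteq> {..<n}" "distinct [a, b, c, d]"
    and "star a \<subseteq> star b \<union> star c \<union> star d" "star b \<subseteq> star a \<union> star c \<union> star d"
    and "star c \<subseteq> star a \<union> star b \<union> star d" "star d \<subseteq> star a \<union> star b \<union> star c"
  shows "{a, b, c, d} \<in> star a \<inter> star b \<inter> star c \<inter> star d"
proof -
  have "{a, b, c, d} \<in> E"
  proof (rule tangled_is_edge)
    show "card {a, b, c, d} = 4"
      using assms(2) by simp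
    fix v f assume "v \<in> {a, b, c, d}" "f \<in> star v"
    then show "\<exists>w\<in>{a, b, c, d}. w \<noteq> v \<and> f \<in> star w"
      using assms(2-6) by auto
  qed (fact assms(1))
  then show ?thesis
    by (simp add: star_def)
qed

text \<open>In \<open>{p, x, y, q}\<close> the vertices \<open>p\<close> and \<open>x\<close> share
  \<open>f\<close>, \<open>x\<close> and \<open>y\<close> share \<open>h\<close>, \<open>y\<close>
  and \<open>q\<close> share \<open>g\<close>. So the quadruple is a hyperedge, and it would equal
  both \<open>f\<close> and \<open>g\<close>.\<close>

lemma two_pendants_not_linked:
  assumes "star p = {f}" "star x = {f, h}" "star y = {g, h}" "star q = {g}"
    and "f \<noteq> g" "f \<noteq> h" "g \<noteq> h"
  shows False
proof -
  let ?S = "{p, x, y, q}"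
  have "star p \<noteq> star x" "star p \<noteq> star y" "star p \<noteq> star q" "star x \<noteq> star y" "star x \<noteq> star q" "star y \<noteq> star q"
    unfolding assms(1-4) using assms(5-) by blast+
  then have ne: "p \<noteq> x" "p \<noteq> y" "p \<noteq> q" "x \<noteq> y" "x \<noteq> q" "y \<noteq> q"
    by auto
  have "?S \<subseteq> {..<n}"
    by (simp add: star_nonempty_less assms(1-4))
  then have "?S \<in> star p \<inter> star x \<inter> star y \<inter> star q"
    by (rule tangled_quadruple_is_edge) (use ne in simp, unfold assms(1-4), blast+)
  then show False
    unfolding assms(1-4) using assms(5) by blast
qed

lemma card_isolated_le: "card isolated \<le> 3"
proof (rule ccontr)
  assume "\<not> card isolated \<le> 3"
  then have "4 \<le> card isolated"
    by simp
  then obtain S where S: "S \<subseteq> isolated" "card S = 4"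
    by (metis obtain_subset_with_card_n)
  then have "S \<in> E"
    by (intro tangled_is_edge) (auto simp: isolated_def)
  with S have "S = {}"
    by (auto simp: isolated_def star_def)
  with S show False
    by simp
qed

section \<open>Twin pendant hyperedges and isolated vertices\<close>

lemma star_eq_pair:
  assumes "f \<in> star v" "g \<in> star v" "f \<noteq> g" "card (star v) \<le> 2"
  shows "star v = {f, g}"
  by (rule card_seteq[symmetric]) (use assms finite_star in auto)

text \<open>If the two twin pairs have equal stars, one pair together with \<open>p\<close> and
  \<open>q\<close> is a forbidden quadruple. Otherwise the two pairs form a hyperedge
  \<open>e\<close>, which leads to another one.\<close>

lemma twin_pendant_unique:
  assumes "f \<in> twin_pendant" "g \<in> twin_pendant"
  shows "f = g"
proof (rule ccontr)
  assume "f \<noteq> g"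
  obtain p u v where p: "star p = {f}" and u: "f \<in> star u" "u \<noteq> v" "star v = star u"
      and du: "card (star u) \<le> 2" and f: "f \<in> E"
    using assms(1) by (auto simp: twin_pendant_def pendant_def star_def)
  obtain q u' v' where q: "star q = {g}" and u': "g \<in> star u'" "u' \<noteq> v'" "star v' = star u'"
      and du': "card (star u') \<le> 2" and g: "g \<in> E"
    using assms(2) by (auto simp: twin_pendant_def pendant_def star_def)
  show False
  proof (cases "star u = star u'")
    case True
    have star: "star u = {f, g}"
      by (rule star_eq_pair) (use u(1) u'(1) True du \<open>f \<noteq> g\<close> in simp_all)
    have "star p \<noteq> star u" "star p \<noteq> star v" "star p \<noteq> star q" "star u \<noteq> star q" "star v \<noteq> star q"
      unfolding p q u(3) star using \<open>f \<noteq> g\<close> by blast+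
    then have ne: "p \<noteq> u" "p \<noteq> v" "p \<noteq> q" "u \<noteq> q" "v \<noteq> q"
      by auto
    have "{p, u, v, q} \<subseteq> {..<n}"
      by (simp add: star_nonempty_less p q u star)
    then have "{p, u, v, q} \<in> star p \<inter> star u \<inter> star v \<inter> star q"
      by (rule tangled_quadruple_is_edge) (use ne u in simp, unfold p q u(3) star, blast+)
    then show False
      unfolding p q using \<open>f \<noteq> g\<close> by blast
  next
    case False
    have ne: "u \<noteq> u'" "u \<noteq> v'" "v \<noteq> u'" "v \<noteq> v'"
      using False u u' by metis+
    define e where "e = {u, v, u', v'}"
    have "star w \<noteq> {}" if "w \<in> {u, v, u', v'}" for w
      using that u(1,3) u'(1,3) by force
    then have "{u, v, u', v'} \<subseteq> {..<n}"
      using star_nonempty_less by blast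
    then have "e \<in> star u \<inter> star v \<inter> star u' \<inter> star v'"
      unfolding e_def by (rule tangled_quadruple_is_edge) (use ne u u' in simp, unfold u(3) u'(3), blast+)
    then have e: "e \<in> E" and eu: "e \<in> star u" "e \<in> star u'"
      by (auto simp: in_star_iff)
    \<comment> \<open>If \<open>u\<close> has degree one, then \<open>e = f\<close>, so
      \<open>u'\<close> and \<open>v'\<close> link \<open>f\<close> to \<open>g\<close>. The names
      are fresh because the claim is also applied with \<open>f\<close> and \<open>g\<close>
      exchanged.\<close>
    have one: False if "star u = {f}" "f \<in> star u'" "g \<in> star u'" "star q = {g}" "u' \<noteq> v'"
        "star v' = star u'" "f \<noteq> g" "card (star u') \<le> 2"
      for u u' v' q f g
    proof -
      have star: "star u' = {f, g}"
        using that(2,3,7,8) by (rule star_eq_pair)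
      have "star u \<noteq> star u'" "star u \<noteq> star v'" "star u \<noteq> star q" "star u' \<noteq> star q" "star v' \<noteq> star q"
        unfolding that(1,4,6) star using that(7) by blast+
      then have ne: "u \<noteq> u'" "u \<noteq> v'" "u \<noteq> q" "u' \<noteq> q" "v' \<noteq> q"
        by auto
      have "{u, u', v', q} \<subseteq> {..<n}"
        by (simp add: star_nonempty_less that(1,4,6) star)
      then have "{u, u', v', q} \<in> star u \<inter> star u' \<inter> star v' \<inter> star q"
        by (rule tangled_quadruple_is_edge) (use ne that(5) in simp, unfold that(1,4,6) star, blast+)
      then show False
        unfolding that(1,4) using that(7) by blast
    qed
    show False
    proof (cases "star u = {f} \<or> star u' = {g}")
      case True
      then show False
      proof
        assume "star u = {f}"
        moreover from this have "f \<in> star u'"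
          using eu by simp
        ultimately show False
          using one u' q du' \<open>f \<noteq> g\<close> by metis
      next
        assume "star u' = {g}"
        moreover from this have "g \<in> star u"
          using eu by simp
        ultimately show False
          using one u p du \<open>f \<noteq> g\<close> by metis
      qed
    next
      case deg2: False
      \<comment> \<open>Now \<open>u\<close> and \<open>u'\<close> have degree two, so
        \<open>e\<close> contains neither \<open>p\<close> nor \<open>q\<close>. Hence
        \<open>e\<close> differs from \<open>f\<close> and \<open>g\<close> and is linked to
        both.\<close>
      have not_e: "w \<notin> e" if "star w = {f} \<or> star w = {g}" for w
      proof
        assume "w \<in> e"
        then have "star w = star u \<or> star w = star u'"
          using u(3) u'(3) by (auto simp: e_def)
        then show False
          using that deg2 u(1) u'(1) \<open>f \<noteq> g\<close> by auto
      qed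
      have "p \<in> f" "q \<in> g"
        using p q by (metis in_star_iff singletonI)+
      then have ef: "e \<noteq> f" and eg: "e \<noteq> g"
        using not_e p q by blast+
      have "star u = {f, e}" "star u' = {g, e}"
        using star_eq_pair u(1) u'(1) eu du du' ef eg by metis+
      then show False
        using two_pendants_not_linked p q \<open>f \<noteq> g\<close> ef eg by metis
    qed
  qed
qed

lemma finite_isolated: "finite isolated"
  by (simp add: isolated_def)

lemma card_twin_pendant_le: "card twin_pendant \<le> 1"
  using twin_pendant_unique by (simp add: card_le_Suc0_iff_eq finite_edges twin_pendant_def pendant_def)

text \<open>Two isolated vertices and a twin pair would form a hyperedge.\<close>

lemma twin_pendant_isolated:
  assumes "twin_pendant \<noteq> {}"
  shows "card isolated \<le> 1"
proof (rule ccontr)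
  assume "\<not> card isolated \<le> 1"
  then obtain a b where ab: "a \<in> isolated" "b \<in> isolated" "a \<noteq> b"
    using finite_isolated by (metis card_le_Suc0_iff_eq One_nat_def)
  obtain f u v where u: "f \<in> star u" "u \<noteq> v" "star v = star u"
    using assms by (auto simp: twin_pendant_def pendant_def star_def)
  have ne: "a \<noteq> u" "a \<noteq> v" "b \<noteq> u" "b \<noteq> v"
    using ab u by (auto simp: isolated_def)
  have "star u \<noteq> {}" "star v \<noteq> {}"
    using u by auto
  then have "{a, b, u, v} \<subseteq> {..<n}"
    using ab by (simp add: star_nonempty_less isolated_def)
  then have "{a, b, u, v} \<in> star a \<inter> star b \<inter> star u \<inter> star v"
    by (rule tangled_quadruple_is_edge) (use ab u ne in \<open>auto simp: isolated_def\<close>)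
  then show False
    using ab by (auto simp: isolated_def)
qed

lemma isolated_no_linked_pendants:
  assumes "isolated \<noteq> {}" "star p = {f}" "star x = {f, h}" "star q = {h}" "f \<noteq> h"
  shows False
proof -
  obtain a where a: "a < n" "star a = {}"
    using assms(1) by (auto simp: isolated_def)
  have "star a \<noteq> star p" "star a \<noteq> star x" "star a \<noteq> star q" "star p \<noteq> star x" "star p \<noteq> star q" "star x \<noteq> star q"
    unfolding a(2) assms(2-4) using assms(5) by blast+
  then have ne: "a \<noteq> p" "a \<noteq> x" "a \<noteq> q" "p \<noteq> x" "p \<noteq> q" "x \<noteq> q"
    by auto
  have "{a, p, x, q} \<subseteq> {..<n}"
    by (simp add: star_nonempty_less assms(2-4) a(1))
  then have "{a, p, x, q} \<in> star a \<inter> star p \<inter> star x \<inter> star q"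
    by (rule tangled_quadruple_is_edge) (use ne in simp, unfold a(2) assms(2-4), blast+)
  then show False
    unfolding a(2) by blast
qed

section \<open>Donors of pendant hyperedges\<close>

text \<open>A common donor would be linked to two pendant hyperedges. Thus the slack of a donor is
  spent only once.\<close>

lemma donors_disjoint:
  assumes "f \<in> pendant" "g \<in> pendant" "f \<noteq> g"
  shows "donors f \<inter> donors g = {}"
proof (rule ccontr)
  assume "donors f \<inter> donors g \<noteq> {}"
  then obtain h x y where "h \<notin> pendant" "star x = {f, h}" "star y = {g, h}"
    by (auto simp: donors_def)
  moreover obtain p q where "star p = {f}" "star q = {g}"
    using assms by (auto simp: pendant_def)
  ultimately show False
    using two_pendants_not_linked assms by metis
qed

text \<open>The other hyperedge \<open>h x\<close> through a degree-two vertex \<open>x\<close>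
  depends injectively on \<open>x\<close>, as \<open>f\<close> has no twins. It is a donor unless
  pendant, and two pendant ones would both be linked to \<open>f\<close>. An isolated vertex rules
  out even one.\<close>

lemma card_degree_two_le:
  assumes "f \<in> pendant - twin_pendant"
  defines "L \<equiv> {x \<in> f. card (star x) = 2}"
  shows "card L \<le> card (donors f) + 1"
    and "isolated \<noteq> {} \<Longrightarrow> card L \<le> card (donors f)"
proof -
  obtain p where p: "star p = {f}" and f: "f \<in> E"
    using assms(1) by (auto simp: pendant_def)
  define h where "h x = (SOME h. star x = {f, h} \<and> f \<noteq> h)" for x
  have h: "star x = {f, h x} \<and> f \<noteq> h x" if "x \<in> L" for x
  proof -
    have "card (star x) = 2" "f \<in> star x"
      using f that by (auto simp: L_def star_def)
    then obtain a b where "star x = {a, b}" "a \<noteq> b" "f = a \<or> f = b"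
      by (metis card_2_iff insert_iff singletonD)
    then have "\<exists>h. star x = {f, h} \<and> f \<noteq> h"
      by (metis insert_commute)
    then show ?thesis
      unfolding h_def by (rule someI_ex)
  qed
  have inj: "inj_on h L"
  proof (rule inj_onI)
    fix x y assume xy: "x \<in> L" "y \<in> L" "h x = h y"
    then have "star x = star y"
      using h[of x] h[of y] by simp
    moreover have "card (star x) \<le> 2" "x \<in> f" "y \<in> f"
      using xy by (simp_all add: L_def)
    ultimately show "x = y"
      using assms(1) by (auto simp: twin_pendant_def)
  qed
  have fin: "finite L" "finite (donors f)"
    using finite_edge[OF f] finite_edges by (auto simp: L_def donors_def)
  have donor: "h x \<in> donors f" if "x \<in> L" "h x \<notin> pendant" for x
  proof -
    have "h x \<in> star x"
      using h[OF that(1)] by simp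
    then show ?thesis
      using that h[of x] by (auto simp: donors_def in_star_iff)
  qed
  define P where "P = {x \<in> L. h x \<in> pendant}"
  have "x = y" if xy: "x \<in> P" "y \<in> P" for x y
  proof (rule ccontr)
    assume "x \<noteq> y"
    with xy inj have "h x \<noteq> h y"
      by (auto simp: P_def inj_on_def)
    moreover obtain q r where "star q = {h x}" "star r = {h y}"
      using xy by (auto simp: P_def pendant_def)
    moreover have "star x = {h x, f}" "star y = {h y, f}" "h x \<noteq> f" "h y \<noteq> f"
      using h[of x] h[of y] xy by (auto simp: P_def)
    ultimately show False
      using two_pendants_not_linked by metis
  qed
  then have P: "card P \<le> 1"
    using fin by (simp add: card_le_Suc0_iff_eq P_def)
  have "card (L - P) \<le> card (donors f)"
    by (rule card_inj_on_le[of h]) (use inj fin donor in \<open>auto simp: P_def inj_on_def\<close>)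
  moreover have "card L = card (L - P) + card P"
  proof -
    have "P \<subseteq> L"
      by (auto simp: P_def)
    then show ?thesis
      using fin(1) by (simp add: card_Diff_subset card_mono finite_subset)
  qed
  ultimately show "card L \<le> card (donors f) + 1"
    using P by simp
  show "card L \<le> card (donors f)" if "isolated \<noteq> {}"
  proof -
    have "h x \<notin> pendant" if "x \<in> L" for x
      using isolated_no_linked_pendants[OF \<open>isolated \<noteq> {}\<close> p] h[OF that] by (auto simp: pendant_def)
    then have "P = {}"
      by (auto simp: P_def)
    then show ?thesis
      using \<open>card (L - P) \<le> card (donors f)\<close> by simp
  qed
qed

section \<open>Weights of hyperedges\<close>

lemma card_star_pos: "f \<in> E \<Longrightarrow> v \<in> f \<Longrightarrow> card (star v) \<ge> 1"
  using finite_star by (metis One_nat_def Suc_leI card_gt_0_iff empty_iff in_star_iff)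

lemma card_star_eq_1: "f \<in> E \<Longrightarrow> v \<in> f \<Longrightarrow> card (star v) = 1 \<Longrightarrow> star v = {f}"
  by (metis card_1_singletonE in_star_iff singletonD)

lemma weight_le_4: "f \<in> E \<Longrightarrow> weight f \<le> 4"
proof -
  assume f: "f \<in> E"
  have "weight f \<le> (\<Sum>v\<in>f. 1)"
    unfolding weight_def using card_star_pos[OF f] by (intro sum_mono) (fastforce simp: divide_le_eq)
  then show ?thesis
    using card_edge[OF f] by simp
qed

lemma weight_nonpendant:
  assumes "f \<in> E - pendant"
  shows "weight f \<le> 2"
proof -
  have "1 / real (card (star v)) \<le> 1 / 2" if "v \<in> f" for v
  proof -
    have "card (star v) \<noteq> 1" "card (star v) \<ge> 1"
      using assms that card_star_eq_1 card_star_pos by (auto simp: pendant_def)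
    then show ?thesis
      by (intro divide_left_mono) auto
  qed
  then have "weight f \<le> (\<Sum>v\<in>f. 1 / 2)"
    unfolding weight_def by (intro sum_mono) auto
  then show ?thesis
    using assms card_edge by simp
qed

text \<open>One vertex of degree one gives 1; a second would make \<open>f\<close> a twin pendant.
  The other three give at most 1/3 each, plus 1/6 when the degree is two.\<close>

lemma weight_pendant:
  assumes "f \<in> pendant - twin_pendant"
  shows "weight f \<le> 2 + card {x \<in> f. card (star x) = 2} / 6"
proof -
  obtain p where p: "star p = {f}"
    using assms by (auto simp: pendant_def)
  then have f: "f \<in> E" "p \<in> f"
    by (metis in_star_iff singletonI)+
  have le: "1 / real (card (star v)) \<le> 1 / 3 + (if card (star v) = 2 then 1 / 6 else 0)"
    if "v \<in> f - {p}" for v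
  proof -
    have "card (star v) \<noteq> 1"
    proof
      assume 1: "card (star v) = 1"
      then have "star v = star p"
        using card_star_eq_1[OF f(1) _ 1] that unfolding p by blast
      then have "f \<in> twin_pendant"
        unfolding twin_pendant_def using assms that f 1 by force
      then show False
        using assms by blast
    qed
    moreover have "card (star v) \<ge> 1"
      using card_star_pos that f by auto
    ultimately consider "card (star v) = 2" | "card (star v) \<ge> 3"
      by linarith
    then show ?thesis
    proof cases
      case 2
      then have "1 / real (card (star v)) \<le> 1 / 3"
        by (intro divide_left_mono) auto
      with 2 show ?thesis
        by simp
    qed simp
  qed
  have "weight f = 1 + (\<Sum>v\<in>f - {p}. 1 / card (star v))"
    unfolding weight_def using f finite_edge p by (subst sum.remove[of _ p]) auto
  also have "\<dots> \<le> 1 + (\<Sum>v\<in>f - {p}. 1 / 3 + (if card (star v) = 2 then 1 / 6 else 0))"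
    using le by (intro add_left_mono sum_mono) auto
  also have "\<dots> = 2 + (\<Sum>v\<in>f - {p}. if card (star v) = 2 then 1 / 6 else 0)"
    using f finite_edge card_edge by (simp add: sum.distrib)
  also have "(\<Sum>v\<in>f - {p}. if card (star v) = 2 then 1 / 6 else (0::real))
      = card {x \<in> f. card (star x) = 2} / 6"
  proof -
    have "{x \<in> f - {p}. card (star x) = 2} = {x \<in> f. card (star x) = 2}"
      using p by auto
    then show ?thesis
      using f finite_edge by (simp add: sum.If_cases Int_def)
  qed
  finally show ?thesis .
qed

text \<open>Double counting: a vertex of degree \<open>d > 0\<close> hands out \<open>d\<close>
  shares of \<open>1 / d\<close>.\<close>

lemma sum_weight: "(\<Sum>f\<in>E. weight f) + card isolated = n"
proof -
  have "(\<Sum>f\<in>E. weight f) = (\<Sum>f\<in>E. \<Sum>v | v \<in> {..<n} \<and> v \<in> f. 1 / card (star v))"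
    unfolding weight_def
  proof (intro sum.cong refl)
    fix f assume "f \<in> E"
    then show "f = {v. v \<in> {..<n} \<and> v \<in> f}"
      using edge_subset by auto
  qed
  also have "\<dots> = (\<Sum>v<n. \<Sum>f | f \<in> E \<and> v \<in> f. 1 / card (star v))"
    by (rule sum.swap_restrict) (use finite_edges in auto)
  also have "\<dots> = (\<Sum>v<n. if star v = {} then 0 else 1)"
  proof (intro sum.cong refl)
    fix v
    have "(\<Sum>f | f \<in> E \<and> v \<in> f. 1 / real (card (star v))) = card (star v) * (1 / card (star v))"
      unfolding star_def by simp
    also have "\<dots> = (if star v = {} then 0 else 1)"
      using finite_star[of v] by auto
    finally show "(\<Sum>f | f \<in> E \<and> v \<in> f. 1 / real (card (star v))) = (if star v = {} then 0 else 1)" .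
  qed
  also have "\<dots> = (\<Sum>v<n. 1 - (if star v = {} then 1 else 0))"
    by (intro sum.cong) auto
  also have "\<dots> = n - real (card isolated)"
    by (simp add: sum_subtractf sum.If_cases isolated_def Int_def)
  finally show ?thesis
    by simp
qed

text \<open>Discharging with target average \<open>c\<close>: each hyperedge that is not pendant has
  slack \<open>c - 2\<close> and gives it to at most one pendant hyperedge; a twin pendant exceeds
  \<open>c\<close> by at most \<open>4 - c\<close>.\<close>

lemma sum_weight_le:
  fixes c :: real
  assumes c: "c \<ge> 2"
    and local: "\<And>f. f \<in> pendant - twin_pendant \<Longrightarrow> weight f \<le> c + (c - 2) * card (donors f)"
  shows "(\<Sum>f\<in>E. weight f) \<le> c * card E + (4 - c) * card twin_pendant"
proof -
  let ?N = "E - pendant" and ?P = "pendant - twin_pendant"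
  have sub: "pendant \<subseteq> E" "twin_pendant \<subseteq> pendant"
    by (auto simp: pendant_def twin_pendant_def)
  have fin: "finite pendant" "finite twin_pendant"
    using sub finite_edges by (auto intro: finite_subset)
  have split: "sum g E = sum g ?N + (sum g ?P + sum g twin_pendant)" for g :: "nat set \<Rightarrow> real"
    using sum.subset_diff[OF sub(1) finite_edges, of g] sum.subset_diff[OF sub(2) fin(1), of g] by simp
  have "(\<Sum>f\<in>?P. card (donors f)) = card (\<Union>f\<in>?P. donors f)"
    using fin finite_edges donors_disjoint
    by (intro card_UN_disjoint[symmetric]) (auto simp: donors_def)
  also have "\<dots> \<le> card ?N"
    using finite_edges by (intro card_mono) (auto simp: donors_def)
  finally have donors: "(\<Sum>f\<in>?P. real (card (donors f))) \<le> card ?N"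
    by (metis of_nat_le_iff of_nat_sum)
  have "(\<Sum>f\<in>E. weight f) \<le> (\<Sum>f\<in>?N. 2) + ((\<Sum>f\<in>?P. c + (c - 2) * card (donors f)) + (\<Sum>f\<in>twin_pendant. 4))"
    unfolding split using weight_nonpendant local weight_le_4 sub
    by (intro add_mono sum_mono) auto
  also have "\<dots> = 2 * card ?N + (c * card ?P + (c - 2) * (\<Sum>f\<in>?P. real (card (donors f)))) + 4 * card twin_pendant"
    by (simp add: sum.distrib sum_distrib_left)
  also have "\<dots> \<le> 2 * card ?N + (c * card ?P + (c - 2) * card ?N) + 4 * card twin_pendant"
    using c donors by (intro add_mono mult_left_mono) auto
  also have "\<dots> = c * card E + (4 - c) * card twin_pendant"
    using split[of "\<lambda>_. 1"] by (simp add: algebra_simps)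
  finally show ?thesis .
qed

lemma edges_lower_bound:
  assumes "n \<ge> 100"
  shows "6 * real n - 11 \<le> 13 * card E"
proof (cases "isolated = {}")
  case True
  \<comment> \<open>With \<open>d\<close> donors the weight is at most
    \<open>2 + (d + 1) / 6 = 13 / 6 + d / 6\<close>.\<close>
  have "(\<Sum>f\<in>E. weight f) \<le> 13 / 6 * card E + (4 - 13 / 6) * card twin_pendant"
  proof (rule sum_weight_le)
    fix f assume f: "f \<in> pendant - twin_pendant"
    show "weight f \<le> 13 / 6 + (13 / 6 - 2) * real (card (donors f))"
      using weight_pendant[OF f] card_degree_two_le(1)[OF f] by simp
  qed simp
  then show ?thesis
    using sum_weight True card_twin_pendant_le by simp
next
  case False
  \<comment> \<open>Now the number \<open>l\<close> of degree-two vertices is at most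
    \<open>d\<close> and at most 3, and \<open>l / 6 \<le> 1 / 8 + l / 8\<close> holds exactly for
    \<open>l \<le> 3\<close>.\<close>
  have "(\<Sum>f\<in>E. weight f) \<le> 17 / 8 * card E + (4 - 17 / 8) * card twin_pendant"
  proof (rule sum_weight_le)
    fix f assume f: "f \<in> pendant - twin_pendant"
    let ?L = "{x \<in> f. card (star x) = 2}"
    obtain p where p: "star p = {f}"
      using f by (auto simp: pendant_def)
    then have fE: "f \<in> E" "p \<in> f"
      by (metis in_star_iff singletonI)+
    have "card ?L \<le> card (f - {p})"
      using p fE finite_edge by (intro card_mono) auto
    then have "card ?L \<le> 3"
      using fE card_edge finite_edge by simp
    then show "weight f \<le> 17 / 8 + (17 / 8 - 2) * real (card (donors f))"
      using weight_pendant[OF f] card_degree_two_le(2)[OF f False] by simp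
  qed simp
  \<comment> \<open>At most 3 isolated vertices, or one together with an excess of 15/8. As 17/8 <
    13/6, the better slope absorbs this loss for \<open>n \<ge> 100\<close>.\<close>
  moreover have "real (card isolated) + 15 / 8 * card twin_pendant \<le> 3"
    using card_isolated_le card_twin_pendant_le twin_pendant_isolated
    by (cases "twin_pendant = {}") auto
  ultimately show ?thesis
    using sum_weight assms by simp
qed

end

subsection \<open>Construction\<close>

text \<open>Lets the construction use vertices of any type; a bijection onto \<open>{..<n}\<close>
  carries it over.\<close>

lemma wsat4_B4_le:
  fixes W :: "'a set" and F :: "'a set set"
  assumes "finite W" "card W = n"
    and uniform: "\<And>f. f \<in> F \<Longrightarrow> f \<subseteq> W \<and> card f = 4"
    and semisat: "\<And>e. e \<subseteq> W \<Longrightarrow> card e = 4 \<Longrightarrow> e \<notin> F \<Longrightarrow> \<exists>f\<in>F. card (e \<inter> f) = 1"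
  shows "wsat4_B4 n \<le> card F"
proof -
  obtain h where h: "bij_betw h W {..<n}"
    using assms(1,2) by (metis ex_bij_betw_finite_nat atLeast0LessThan)
  then have inj: "inj_on h W" and img: "h ` W = {..<n}"
    by (auto simp: bij_betw_def)
  let ?E = "(`) h ` F"
  have card_img: "card (h ` f) = card f" if "f \<subseteq> W" for f
    using inj that by (intro card_image) (rule inj_on_subset)
  have "B4_semisat n ?E"
    unfolding B4_semisat_def uniform4_def
  proof (intro conjI ballI allI impI)
    fix e assume "e \<in> ?E"
    then show "e \<subseteq> {..<n}" "card e = 4"
      using uniform img card_img by auto
  next
    fix e assume e: "e \<subseteq> {..<n} \<and> card e = 4 \<and> e \<notin> ?E"
    then obtain e' where e': "e' \<subseteq> W" "e = h ` e'"
      using img by (metis subset_imageE)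
    with e card_img have "card e' = 4" "e' \<notin> F"
      by auto
    then obtain f where f: "f \<in> F" "card (e' \<inter> f) = 1"
      using semisat e' by blast
    have "e \<inter> h ` f = h ` (e' \<inter> f)"
      using inj e' uniform[OF f(1)] by (simp add: inj_on_image_Int)
    then have "card (e \<inter> h ` f) = 1"
      using card_img[of "e' \<inter> f"] e' f(2) by (simp add: le_infI1)
    then show "\<exists>f\<in>?E. card (e \<inter> f) = 1"
      using f by blast
  qed
  moreover have "inj_on ((`) h) F"
    using inj uniform by (auto simp: inj_on_def inj_on_image_eq_iff)
  then have "card ?E = card F"
    by (rule card_image)
  ultimately show ?thesis
    unfolding wsat4_B4_def by (metis (mono_tags, lifting) Least_le)
qed

section \<open>Tangled sets of edges and half-edges\<close>

text \<open>A member \<open>{a, b}\<close> of \<open>V\<close> is an edge of a graph if \<open>a \<noteq> b\<close> and a half-edge at \<open>a\<close> if \<open>a = b\<close>.\<close>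

lemma card_tangled_eq_3:
  fixes V :: "'a set set"
  assumes pairs: "\<And>v. v \<in> V \<Longrightarrow> \<exists>a b. v = {a, b}"
    and no_square: "\<And>a b c d. {a, b} \<in> V \<Longrightarrow> {b, c} \<in> V \<Longrightarrow> {c, d} \<in> V \<Longrightarrow> {d, a} \<in> V \<Longrightarrow>
      distinct [a, b, c, d] \<Longrightarrow> False"
    and no_triangle: "\<And>a b c. {a} \<in> V \<Longrightarrow> {a, b} \<in> V \<Longrightarrow> {b, c} \<in> V \<Longrightarrow> {c, a} \<in> V \<Longrightarrow>
      distinct [a, b, c] \<Longrightarrow> False"
    and far: "\<And>a b c. {b} \<in> V \<Longrightarrow> {c} \<in> V \<Longrightarrow> {a, b} \<in> V \<Longrightarrow> {a, c} \<in> V \<Longrightarrow>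
      a \<noteq> b \<Longrightarrow> a \<noteq> c \<Longrightarrow> b = c"
    and S: "S \<subseteq> V" "S \<noteq> {}" "finite S" "card S \<le> 4"
    and tangled: "\<And>a v. v \<in> S \<Longrightarrow> a \<in> v \<Longrightarrow> \<exists>w\<in>S. w \<noteq> v \<and> a \<in> w"
  shows "card S = 3"
proof -
  have pair: "\<exists>b. v = {a, b}" if "v \<in> S" "a \<in> v" for v a
    using pairs[of v] S(1) that by (auto simp: insert_commute)
  have cont: "\<exists>c. {b, c} \<in> S \<and> c \<noteq> a" if ab: "{a, b} \<in> S" for a b
  proof -
    obtain w where w: "w \<in> S" "w \<noteq> {a, b}" "b \<in> w"
      using tangled[OF ab] by blast
    then obtain c where "w = {b, c}"
      using pair by blast
    with w show ?thesis
      by (auto simp: insert_commute)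
  qed
  \<comment> \<open>A fourth member of \<open>S\<close> would be the only one containing some node
    outside \<open>\<Union>T\<close>, so it would not be tangled.\<close>
  have three: "card S = 3" if T: "T \<subseteq> S" "card T = 3" and x: "\<And>x. x \<in> S \<Longrightarrow> x \<subseteq> \<Union>T \<Longrightarrow> x \<in> T" for T
  proof (rule ccontr)
    assume "card S \<noteq> 3"
    moreover have "card T \<le> card S"
      using T(1) S(3) by (rule card_mono[rotated])
    ultimately have "card (S - T) = 1"
      using T S(3,4) by (simp add: card_Diff_subset finite_subset)
    then obtain x where diff: "S - T = {x}"
      by (rule card_1_singletonE)
    then have "\<not> x \<subseteq> \<Union>T"
      using x by blast
    then obtain p where "p \<in> x" "p \<notin> \<Union>T"
      by blast
    moreover from this obtain w where "w \<in> S" "w \<noteq> x" "p \<in> w"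
      using tangled[of x p] diff by blast
    ultimately show False
      using diff by blast
  qed
  have five: False if "distinct xs" "length xs = 5" "set xs \<subseteq> S" for xs
    using card_mono[OF S(3) that(3)] distinct_card[OF that(1)] that(2) S(4) by simp
  show ?thesis
  proof (cases "\<exists>p. {p} \<in> S")
    case True
    then obtain p where p: "{p} \<in> S"
      by blast
    then obtain a where a: "{p, a} \<in> S" "a \<noteq> p"
      using cont[of p p] by auto
    show ?thesis
    proof (cases "{a} \<in> S")
      case True
      show ?thesis
      proof (rule three[of "{{p}, {a}, {p, a}}"])
        show "card {{p}, {a}, {p, a}} = 3"
          using a by (auto simp: card_insert_if)
        fix x assume "x \<in> S" "x \<subseteq> \<Union>{{p}, {a}, {p, a}}"
        moreover from this obtain y z where "x = {y, z}"
          using pairs S(1) by blast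
        ultimately show "x \<in> {{p}, {a}, {p, a}}"
          by auto
      qed (use p a True in auto)
    next
      case False
      \<comment> \<open>Walk from the half-edge at \<open>p\<close> through \<open>a\<close>,
        \<open>b\<close>, \<open>c\<close>, \<open>d\<close>. By \<open>far\<close> there is no
        half-edge at \<open>b\<close>, and by \<open>no_triangle\<close> the walk does not return
        from \<open>b\<close> to \<open>p\<close>, so it has five distinct members.\<close>
      obtain b where b: "{a, b} \<in> S" "b \<noteq> p"
        using cont[OF a(1)] by blast
      then have "b \<noteq> a"
        using False by auto
      obtain c where c: "{b, c} \<in> S" "c \<noteq> a"
        using cont[OF b(1)] by blast
      have "c \<noteq> b"
      proof
        assume "c = b"
        then have "{b} \<in> V" "{p} \<in> V" "{a, b} \<in> V" "{a, p} \<in> V"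
          using c b a p S(1) by (auto simp: insert_commute)
        then show False
          using far a(2) b(2) \<open>b \<noteq> a\<close> by metis
      qed
      have "c \<noteq> p"
        using no_triangle[of p a b] c b a p S(1) \<open>b \<noteq> a\<close> by auto
      obtain d where d: "{c, d} \<in> S" "d \<noteq> b"
        using cont[OF c(1)] by blast
      have "{p} \<noteq> {x, y}" if "x \<noteq> p" for x y
        using that by auto
      then have "distinct [{p}, {a, p}, {a, b}, {b, c}, {c, d}]"
        using a(2) b(2) c(2) d(2) \<open>b \<noteq> a\<close> \<open>c \<noteq> b\<close> \<open>c \<noteq> p\<close> by (simp add: doubleton_eq_iff)
      then have False
        by (rule five) (use p a b c d in \<open>simp_all add: insert_commute\<close>)
      then show ?thesis ..
    qed
  next
    case False
    then have ne: "x \<noteq> y" if "{x, y} \<in> S" for x y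
      using that by auto
    \<comment> \<open>Without half-edges, extend an edge at both ends to \<open>d\<close>,
      \<open>a\<close>, \<open>b\<close>, \<open>c\<close>. If \<open>c = d\<close>, then
      \<open>S\<close> is a triangle; otherwise the edges continuing at \<open>c\<close> and
      \<open>d\<close> differ, as there is no 4-cycle, and make five.\<close>
    obtain a b where ab: "{a, b} \<in> S"
      using S(1,2) pairs by blast
    obtain c where c: "{b, c} \<in> S" "c \<noteq> a"
      using cont[OF ab] by blast
    obtain d where d: "{a, d} \<in> S" "d \<noteq> b"
      using cont[of b a] ab by (auto simp: insert_commute)
    have distinct: "a \<noteq> b" "b \<noteq> c" "a \<noteq> d"
      using ne ab c(1) d(1) by blast+
    show ?thesis
    proof (cases "c = d")
      case True
      show ?thesis
      proof (rule three[of "{{a, b}, {b, c}, {a, c}}"])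
        show "card {{a, b}, {b, c}, {a, c}} = 3"
          using distinct c(2) by (simp add: doubleton_eq_iff)
        fix x assume x: "x \<in> S" "x \<subseteq> \<Union>{{a, b}, {b, c}, {a, c}}"
        obtain y z where "x = {y, z}"
          using x(1) pairs S(1) by blast
        then show "x \<in> {{a, b}, {b, c}, {a, c}}"
          using x ne[of y z] by auto
      qed (use ab c d True in auto)
    next
      case False
      obtain x where x: "{c, x} \<in> S" "x \<noteq> b"
        using cont[OF c(1)] by blast
      obtain y where y: "{d, y} \<in> S" "y \<noteq> a"
        using cont[OF d(1)] by blast
      have "{c, x} \<noteq> {d, y}"
      proof
        assume "{c, x} = {d, y}"
        then have "{c, d} \<in> S"
          using False x(1) by (auto simp: doubleton_eq_iff)
        then show False
          using no_square[of a b c d] S(1) ab c d distinct False by (auto simp: insert_commute)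
      qed
      then have False
        by (intro five[of "[{a, b}, {b, c}, {a, d}, {c, x}, {d, y}]"])
          (use ab c d x y distinct False in \<open>auto simp: doubleton_eq_iff\<close>)
      then show ?thesis ..
    qed
  qed
qed

section \<open>A cyclic 4-regular graph with half-edges\<close>

text \<open>
  The nodes of the graph are pairs \<open>(i, s)\<close> with \<open>i\<close> modulo \<open>k\<close> and \<open>s < 6\<close>; an entry \<open>(t, d)\<close> of
  \<open>arcs s\<close> joins \<open>(i, s)\<close> to \<open>(i + d, t)\<close>, and the loops \<open>(s, 0)\<close> at \<open>s = 0, 1\<close> are the half-edges.
  The shifts on the complete graph with nodes 2, 3, 4, 5 are chosen such that no 4-cycle closes up
  modulo \<open>k \<ge> 8\<close>.
\<close>

definition arcs :: "nat \<Rightarrow> (nat \<times> int) list" where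
  "arcs s = [[(0, 0), (1, 0), (2, 0), (3, 0)],
             [(1, 0), (0, 0), (4, 0), (5, 0)],
             [(0, 0), (3, 2), (4, 1), (5, 2)],
             [(0, 0), (2, -2), (4, 2), (5, 1)],
             [(1, 0), (2, -1), (3, -2), (5, 1)],
             [(1, 0), (2, -2), (3, -1), (4, -1)]] ! s"

text \<open>Reverse arcs make the graph undirected; distinct target tags make it 4-regular.
  Quantifying over explicit lists lets the checks be evaluated.\<close>

lemma arcs_check:
  "\<forall>s\<in>set [0..<6]. distinct (map fst (arcs s)) \<and> length (arcs s) = 4 \<and> (\<forall>(t, d)\<in>set (arcs s).
     t < 6 \<and> (s, -d) \<in> set (arcs t) \<and> (s = t \<longrightarrow> d = 0))"
  by code_simp

text \<open>One direction of every edge, so that each is counted once: 11 edges and 2 half-edges per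
  residue.\<close>

definition forward_arcs :: "(nat \<times> nat \<times> int) list" where
  "forward_arcs = concat (map (\<lambda>s. map (Pair s) (filter (\<lambda>(t, d). s \<le> t) (arcs s))) [0..<6])"

lemma forward_arcs_check:
  "length forward_arcs = 13 \<and> distinct (map (\<lambda>(s, t, d). (s, t)) forward_arcs)"
  by code_simp

lemma arcs_loop: "\<forall>s\<in>set [0..<6]. \<forall>(t, d)\<in>set (arcs s). s = t \<longrightarrow> s < 2"
  by code_simp

text \<open>The bound by 8 turns a total shift divisible by \<open>k \<ge> 8\<close> into a total
  shift 0, which only backtracking walks have.\<close>

lemma arcs_square:
  "\<forall>s\<in>set [0..<6]. \<forall>(t, d1)\<in>set (arcs s). s \<noteq> t \<longrightarrow> (\<forall>(u, d2)\<in>set (arcs t). t \<noteq> u \<longrightarrow>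
     (\<forall>(w, d3)\<in>set (arcs u). u \<noteq> w \<longrightarrow> (\<forall>(s', d4)\<in>set (arcs w). w \<noteq> s' \<longrightarrow> s' = s \<longrightarrow>
       \<bar>d1 + d2 + d3 + d4\<bar> < 8 \<and>
       (d1 + d2 + d3 + d4 = 0 \<longrightarrow> u = s \<and> d1 + d2 = 0 \<or> w = t \<and> d2 + d3 = 0))))"
  by code_simp

lemma arcs_triangle:
  "\<forall>s\<in>set [0, 1]. \<forall>(t, d1)\<in>set (arcs s). s \<noteq> t \<longrightarrow> (\<forall>(u, d2)\<in>set (arcs t). t \<noteq> u \<longrightarrow>
     (\<forall>(s', d3)\<in>set (arcs u). u \<noteq> s' \<longrightarrow> s' = s \<longrightarrow> \<bar>d1 + d2 + d3\<bar> < 8 \<and> d1 + d2 + d3 \<noteq> 0))"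
  by code_simp

lemma arcs_far:
  "\<forall>s\<in>set [0..<6]. \<forall>(t, d)\<in>set (arcs s). \<forall>(t', d')\<in>set (arcs s).
     t < 2 \<longrightarrow> t' < 2 \<longrightarrow> s \<noteq> t \<longrightarrow> s \<noteq> t' \<longrightarrow> t = t' \<and> d = d'"
  by code_simp


section \<open>Vertices and stars of the construction\<close>

definition links :: "int \<Rightarrow> (int \<times> nat) set set" where
  "links k = {{(i, s), ((i + d) mod k, t)} | i s t d. i \<in> {0..<k} \<and> s < 6 \<and> (t, d) \<in> set (arcs s)}"

lemma arcsD:
  assumes "s < 6" "(t, d) \<in> set (arcs s)"
  shows "t < 6" "(s, - d) \<in> set (arcs t)" "s = t \<Longrightarrow> d = 0"
  using assms arcs_check by fastforce+

lemma links_pair: "v \<in> links k \<Longrightarrow> \<exists>a b. v = {a, b}"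
  unfolding links_def by blast

lemma links_pair_at: "v \<in> links k \<Longrightarrow> a \<in> v \<Longrightarrow> \<exists>b. v = {a, b}"
  using links_pair by fastforce

text \<open>Reverse arcs allow an unordered pair to be read from either end. The divisibility form
  lets shifts be added along walks.\<close>

lemma links_arc:
  assumes "{(i, s), (j, t)} \<in> links k"
  shows "i \<in> {0..<k}" "j \<in> {0..<k}" "s < 6" "t < 6"
    "\<exists>d. (t, d) \<in> set (arcs s) \<and> k dvd j - i - d"
proof -
  obtain i' s' t' d where *: "{(i, s), (j, t)} = {(i', s'), ((i' + d) mod k, t')}"
    "i' \<in> {0..<k}" "s' < 6" "(t', d) \<in> set (arcs s')"
    using assms unfolding links_def by blast
  note arc = arcsD[OF *(3,4)]
  have dvd: "k dvd (i' + d) mod k - i' - d" "k dvd i' - (i' + d) mod k + d"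
    by (simp_all add: mod_eq_dvd_iff[symmetric] algebra_simps)
  have "(i' + d) mod k \<in> {0..<k}"
    using *(2) by simp
  with * arc dvd show "i \<in> {0..<k}" "j \<in> {0..<k}" "s < 6" "t < 6"
    "\<exists>d. (t, d) \<in> set (arcs s) \<and> k dvd j - i - d"
    by (auto simp: doubleton_eq_iff)
qed

lemma dvd_diff_eq:
  fixes i j k :: int
  assumes "k dvd j - i" "i \<in> {0..<k}" "j \<in> {0..<k}"
  shows "i = j"
  using assms by (metis atLeastLessThan_iff mod_eq_dvd_iff mod_pos_pos_trivial)

lemma star_links:
  assumes "i \<in> {0..<k}" "s < 6"
  shows "{v \<in> links k. (i, s) \<in> v} = (\<lambda>(t, d). {(i, s), ((i + d) mod k, t)}) ` set (arcs s)"
proof (intro equalityI subsetI)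
  fix v assume "v \<in> {v \<in> links k. (i, s) \<in> v}"
  then obtain j t where v: "v = {(i, s), (j, t)}" "v \<in> links k"
    using links_pair_at by (metis (lifting) mem_Collect_eq surj_pair)
  then obtain d where d: "(t, d) \<in> set (arcs s)" "k dvd j - i - d" and j: "j \<in> {0..<k}"
    using links_arc by metis
  have "j mod k = (i + d) mod k"
    using d(2) by (simp add: mod_eq_dvd_iff algebra_simps)
  then have "j = (i + d) mod k"
    using j by simp
  then show "v \<in> (\<lambda>(t, d). {(i, s), ((i + d) mod k, t)}) ` set (arcs s)"
    using v d by force
qed (use assms in \<open>auto simp: links_def\<close>)

lemma card_star_links:
  assumes "i \<in> {0..<k}" "s < 6"
  shows "card {v \<in> links k. (i, s) \<in> v} = 4"
proof -
  have dist: "distinct (map fst (arcs s))" "length (arcs s) = 4"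
    using arcs_check assms(2) by auto
  have "inj_on (\<lambda>(t, d). {(i, s), ((i + d) mod k, t)}) (set (arcs s))"
  proof (rule inj_onI, clarify)
    fix t d t' d'
    assume *: "(t, d) \<in> set (arcs s)" "(t', d') \<in> set (arcs s)"
      "{(i, s), ((i + d) mod k, t)} = {(i, s), ((i + d') mod k, t')}"
    then have "t = t'"
      by (auto simp: doubleton_eq_iff)
    with * dist show "t = t' \<and> d = d'"
      by (auto dest: eq_key_imp_eq_value)
  qed
  then have "card {v \<in> links k. (i, s) \<in> v} = card (set (arcs s))"
    unfolding star_links[OF assms] by (rule card_image)
  also have "\<dots> = 4"
    using dist by (simp add: distinct_card distinct_map)
  finally show ?thesis .
qed

lemma links_forward:
  "links k = (\<lambda>(i, s, t, d). {(i, s), ((i + d) mod k, t)}) ` ({0..<k} \<times> set forward_arcs)"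
proof (intro equalityI subsetI)
  fix v assume "v \<in> links k"
  then obtain i s t d where v: "v = {(i, s), ((i + d) mod k, t)}" and i: "i \<in> {0..<k}"
      and s: "s < 6" "(t, d) \<in> set (arcs s)"
    unfolding links_def by blast
  show "v \<in> (\<lambda>(i, s, t, d). {(i, s), ((i + d) mod k, t)}) ` ({0..<k} \<times> set forward_arcs)"
  proof (cases "s \<le> t")
    case True
    then have "(s, t, d) \<in> set forward_arcs"
      using s by (auto simp: forward_arcs_def intro!: image_eqI)
    then show ?thesis
      using v i by force
  next
    case False
    define j where "j = (i + d) mod k"
    have "(t, s, - d) \<in> set forward_arcs"
      using arcsD[OF s] False by (auto simp: forward_arcs_def intro!: image_eqI)
    moreover have "j \<in> {0..<k}" "(j + - d) mod k = i"
      using i by (simp_all add: j_def mod_diff_left_eq)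
    moreover have "v = {(j, t), ((j + - d) mod k, s)}"
      using calculation v by (auto simp: j_def)
    ultimately show ?thesis
      by (intro image_eqI[of _ _ "(j, t, s, - d)"]) auto
  qed
next
  fix v assume "v \<in> (\<lambda>(i, s, t, d). {(i, s), ((i + d) mod k, t)}) ` ({0..<k} \<times> set forward_arcs)"
  then show "v \<in> links k"
    by (fastforce simp: links_def forward_arcs_def)
qed

text \<open>As \<open>s \<le> t\<close> orients each link, the link determines its tags, hence the
  shift, hence \<open>i\<close>; a loop has shift 0.\<close>

lemma card_links: "card (links k) = nat k * 13"
proof -
  have L: "s < 6 \<and> s \<le> t \<and> (t, d) \<in> set (arcs s)" if "(s, t, d) \<in> set forward_arcs" for s t d
    using that by (auto simp: forward_arcs_def)
  have key: "d = d'" if "(s, t, d) \<in> set forward_arcs" "(s, t, d') \<in> set forward_arcs" for s t d d'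
  proof -
    have "inj_on (\<lambda>(s, t, d). (s, t)) (set forward_arcs)"
      using forward_arcs_check by (simp add: distinct_map)
    then show ?thesis
      using inj_onD[of _ _ "(s, t, d)" "(s, t, d')"] that by fastforce
  qed
  let ?link = "\<lambda>(i, s, t, d). {(i, s), ((i + d) mod k, t)}"
  have "inj_on ?link ({0..<k} \<times> set forward_arcs)"
  proof (rule inj_onI)
    fix x y
    assume xy: "x \<in> {0..<k} \<times> set forward_arcs" "y \<in> {0..<k} \<times> set forward_arcs" "?link x = ?link y"
    obtain i s t d i' s' t' d' where x: "x = (i, s, t, d)" and y: "y = (i', s', t', d')"
      by (cases x, cases y) auto
    have i: "i \<in> {0..<k}" "i' \<in> {0..<k}"
      and st: "(s, t, d) \<in> set forward_arcs" "(s', t', d') \<in> set forward_arcs"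
      and eq: "{(i, s), ((i + d) mod k, t)} = {(i', s'), ((i' + d') mod k, t')}"
      using xy by (simp_all add: x y)
    have tags: "s = s'" "t = t'"
      using eq L[OF st(1)] L[OF st(2)] by (auto simp: doubleton_eq_iff)
    moreover have d: "d = d'"
      using key st tags by blast
    moreover have "i = i'"
    proof (cases "s = t")
      case True
      then have "d = 0"
        using L[OF st(1)] arcsD(3) by blast
      then show ?thesis
        using eq i d True tags by (auto simp: doubleton_eq_iff)
    next
      case False
      then show ?thesis
        using eq tags by (auto simp: doubleton_eq_iff)
    qed
    ultimately show "x = y"
      by (simp add: x y)
  qed
  then have "card (links k) = card ({0..<k} \<times> set forward_arcs)"
    unfolding links_forward by (rule card_image)
  moreover have "card (set forward_arcs) = 13"
    using forward_arcs_check by (simp add: distinct_card distinct_map)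
  ultimately show ?thesis
    by (simp add: card_cartesian_product)
qed

lemma finite_links: "finite (links k)"
  unfolding links_forward by simp

lemma links_half_edge:
  assumes "{(i, s)} \<in> links k"
  shows "s < 2"
proof -
  have "{(i, s), (i, s)} \<in> links k"
    using assms by simp
  then obtain d where "s < 6" "(s, d) \<in> set (arcs s)"
    using links_arc by metis
  then show ?thesis
    using arcs_loop by fastforce
qed

lemma links_tag_neq:
  assumes "{(i, s), (j, t)} \<in> links k" "(i, s) \<noteq> (j, t)"
  shows "s \<noteq> t"
proof
  assume "s = t"
  then have "k dvd j - i"
    using links_arc[OF assms(1)] arcsD(3) by fastforce
  then have "i = j"
    using links_arc[OF assms(1)] by (intro dvd_diff_eq)
  then show False
    using assms(2) \<open>s = t\<close> by simp
qed

lemma dvd_small: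
  fixes k x :: int
  assumes "k dvd x" "\<bar>x\<bar> < 8" "8 \<le> k"
  shows "x = 0"
  using assms by (meson dvd_imp_le_int order_less_le_trans order_le_less_trans linorder_not_less order_trans abs_ge_self)

text \<open>The shifts around a 4-cycle sum to a multiple of \<open>k\<close>, hence to 0. Then
  \<open>arcs_square\<close> shows that the walk backtracks, so \<open>a = c\<close> or
  \<open>b = d\<close>.\<close>

lemma links_no_square:
  assumes "8 \<le> k" and ab: "{a, b} \<in> links k" and bc: "{b, c} \<in> links k"
    and cd: "{c, d} \<in> links k" and da: "{d, a} \<in> links k" and "distinct [a, b, c, d]"
  shows False
proof -
  obtain i1 s i2 t i3 u i4 w where abcd: "a = (i1, s)" "b = (i2, t)" "c = (i3, u)" "d = (i4, w)"
    by (metis surj_pair)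
  note ab = ab[unfolded abcd] and bc = bc[unfolded abcd] and cd = cd[unfolded abcd] and da = da[unfolded abcd]
  have ne: "s \<noteq> t" "t \<noteq> u" "u \<noteq> w" "w \<noteq> s"
    using links_tag_neq ab bc cd da \<open>distinct [a, b, c, d]\<close> unfolding abcd by (metis distinct_length_2_or_more)+
  obtain d1 d2 d3 d4 where arc: "(t, d1) \<in> set (arcs s)" "(u, d2) \<in> set (arcs t)"
      "(w, d3) \<in> set (arcs u)" "(s, d4) \<in> set (arcs w)"
    and dvd: "k dvd i2 - i1 - d1" "k dvd i3 - i2 - d2" "k dvd i4 - i3 - d3" "k dvd i1 - i4 - d4"
    using links_arc(5)[OF ab] links_arc(5)[OF bc] links_arc(5)[OF cd] links_arc(5)[OF da] by blast
  have "k dvd - ((i2 - i1 - d1) + (i3 - i2 - d2) + (i4 - i3 - d3) + (i1 - i4 - d4))"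
    using dvd by (simp only: dvd_minus_iff dvd_add)
  then have "k dvd d1 + d2 + d3 + d4"
    by (simp add: algebra_simps)
  moreover have *: "\<bar>d1 + d2 + d3 + d4\<bar> < 8 \<and>
       (d1 + d2 + d3 + d4 = 0 \<longrightarrow> u = s \<and> d1 + d2 = 0 \<or> w = t \<and> d2 + d3 = 0)"
    using arcs_square ne arc links_arc(3)[OF ab] by fastforce
  ultimately have "d1 + d2 + d3 + d4 = 0"
    using dvd_small assms(1) by blast
  with * consider "u = s" "d1 + d2 = 0" | "w = t" "d2 + d3 = 0"
    by blast
  then show False
  proof cases
    case 1
    have "k dvd (i2 - i1 - d1) + (i3 - i2 - d2)"
      using dvd by (simp only: dvd_add)
    also have "(i2 - i1 - d1) + (i3 - i2 - d2) = i3 - i1"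
      using 1(2) by simp
    finally have "i1 = i3"
      using links_arc[OF ab] links_arc[OF cd] by (intro dvd_diff_eq)
    then show False
      using 1(1) \<open>distinct [a, b, c, d]\<close> abcd by simp
  next
    case 2
    have "k dvd (i3 - i2 - d2) + (i4 - i3 - d3)"
      using dvd by (simp only: dvd_add)
    also have "(i3 - i2 - d2) + (i4 - i3 - d3) = i4 - i2"
      using 2(2) by simp
    finally have "i2 = i4"
      using links_arc[OF bc] links_arc[OF da] by (intro dvd_diff_eq)
    then show False
      using 2(1) \<open>distinct [a, b, c, d]\<close> abcd by simp
  qed
qed

lemma links_no_triangle:
  assumes "8 \<le> k" and a: "{a} \<in> links k" and ab: "{a, b} \<in> links k" and bc: "{b, c} \<in> links k"
    and ca: "{c, a} \<in> links k" and "distinct [a, b, c]"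
  shows False
proof -
  obtain i1 s i2 t i3 u where abc: "a = (i1, s)" "b = (i2, t)" "c = (i3, u)"
    by (metis surj_pair)
  note ab = ab[unfolded abc] and bc = bc[unfolded abc] and ca = ca[unfolded abc]
  have ne: "s \<noteq> t" "t \<noteq> u" "u \<noteq> s"
    using links_tag_neq ab bc ca \<open>distinct [a, b, c]\<close> unfolding abc by (metis distinct_length_2_or_more)+
  obtain d1 d2 d3 where arc: "(t, d1) \<in> set (arcs s)" "(u, d2) \<in> set (arcs t)" "(s, d3) \<in> set (arcs u)"
    and dvd: "k dvd i2 - i1 - d1" "k dvd i3 - i2 - d2" "k dvd i1 - i3 - d3"
    using links_arc(5)[OF ab] links_arc(5)[OF bc] links_arc(5)[OF ca] by blast
  have "k dvd - ((i2 - i1 - d1) + (i3 - i2 - d2) + (i1 - i3 - d3))"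
    using dvd by (simp only: dvd_minus_iff dvd_add)
  then have "k dvd d1 + d2 + d3"
    by (simp add: algebra_simps)
  moreover have "s \<in> set [0, 1]"
    using links_half_edge[of i1 s k] a by (auto simp: abc less_2_cases_iff)
  then have "\<bar>d1 + d2 + d3\<bar> < 8 \<and> d1 + d2 + d3 \<noteq> 0"
    using arcs_triangle ne arc by fastforce
  ultimately show False
    using dvd_small assms(1) by blast
qed

text \<open>By \<open>arcs_far\<close> both neighbours are reached from \<open>a\<close> by the same
  arc.\<close>

lemma links_far:
  assumes b: "{b} \<in> links k" and c: "{c} \<in> links k" and ab: "{a, b} \<in> links k" and ac: "{a, c} \<in> links k"
    and ne: "a \<noteq> b" "a \<noteq> c"
  shows "b = c"
proof -
  obtain i1 s i2 t i3 u where abc: "a = (i1, s)" "b = (i2, t)" "c = (i3, u)"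
    by (metis surj_pair)
  note ab = ab[unfolded abc] and ac = ac[unfolded abc]
  have tags: "s \<noteq> t" "s \<noteq> u" "t < 2" "u < 2"
    using links_tag_neq[OF ab] links_tag_neq[OF ac] links_half_edge b c ne by (auto simp: abc)
  obtain d1 d2 where arc: "(t, d1) \<in> set (arcs s)" "(u, d2) \<in> set (arcs s)"
    and dvd: "k dvd i2 - i1 - d1" "k dvd i3 - i1 - d2"
    using links_arc(5)[OF ab] links_arc(5)[OF ac] by blast
  have eq: "t = u" "d1 = d2"
    using arcs_far tags arc links_arc(3)[OF ab] by fastforce+
  have "k dvd (i3 - i1 - d2) - (i2 - i1 - d1)"
    using dvd by (simp only: dvd_diff)
  then have "k dvd i3 - i2"
    using eq by (simp add: algebra_simps)
  then have "i2 = i3"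
    using links_arc[OF ab] links_arc[OF ac] by (intro dvd_diff_eq)
  then show ?thesis
    using eq abc by simp
qed

section \<open>Semi-saturation of the construction\<close>

text \<open>A 4-set meeting no star in exactly one vertex is \<open>Q\<close> or has exactly three
  elements in \<open>V\<close>; in the latter case it meets the extra hyperedge \<open>Q\<close> in
  exactly one.\<close>

lemma wsat4_B4_le_6_13:
  assumes "8 \<le> K"
  shows "wsat4_B4 (13 * K + 4) \<le> 6 * K + 1"
proof -
  define k where "k = int K"
  define V where "V = links k"
  \<comment> \<open>The first coordinate \<open>k\<close> lies outside the residues, so these four
    vertices are not links.\<close>
  define Q where "Q = (\<lambda>j. {(k, j)}) ` {..<4::nat}"
  define star where "star a = {v \<in> V. a \<in> v}" for a
  define F where "F = insert Q (star ` ({0..<k} \<times> {..<6}))"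
  have k: "8 \<le> k" and K: "nat k = K"
    using assms by (simp_all add: k_def)
  have nodes: "a \<in> {0..<k} \<times> {..<6}" if va: "v \<in> V" "a \<in> v" for v a
  proof -
    obtain b where "v = {a, b}"
      using links_pair_at va unfolding V_def by blast
    then show ?thesis
      using links_arc[of "fst a" "snd a" "fst b" "snd b" k] va by (auto simp: V_def mem_Times_iff)
  qed
  have disj: "V \<inter> Q = {}"
    using nodes by (fastforce simp: Q_def)
  have Q: "finite Q" "card Q = 4"
    by (simp_all add: Q_def card_image inj_on_def)
  have V: "finite V"
    by (simp add: V_def finite_links)
  have "wsat4_B4 (13 * K + 4) \<le> card F"
  proof (rule wsat4_B4_le)
    show "finite (V \<union> Q)"
      using V Q by simp
    show "card (V \<union> Q) = 13 * K + 4"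
      using V Q disj by (simp add: card_Un_disjoint) (simp add: V_def card_links K)
    show "f \<subseteq> V \<union> Q \<and> card f = 4" if "f \<in> F" for f
      using that Q card_star_links by (auto simp: F_def star_def V_def)
  next
    fix e assume e: "e \<subseteq> V \<union> Q" "card e = 4" "e \<notin> F"
    show "\<exists>f\<in>F. card (e \<inter> f) = 1"
    proof (rule ccontr)
      assume "\<not> (\<exists>f\<in>F. card (e \<inter> f) = 1)"
      then have no1: "card (e \<inter> f) \<noteq> 1" if "f \<in> F" for f
        using that by blast
      have fin: "finite e"
        using e(2) by (simp add: card_ge_0_finite)
      have "card (e \<inter> V) = 3"
      proof (rule card_tangled_eq_3[of V])
        show "e \<inter> V \<noteq> {}"
        proof
          assume "e \<inter> V = {}"
          then have "e = Q"
            using e Q by (intro card_subset_eq) auto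
          then show False
            using e(3) by (simp add: F_def)
        qed
        show "card (e \<inter> V) \<le> 4"
          using e(2) fin by (metis card_mono inf_le1)
        fix a v assume av: "v \<in> e \<inter> V" "a \<in> v"
        then have "star a \<in> F"
          unfolding F_def using nodes by blast
        moreover have "v \<in> e \<inter> star a"
          using av by (simp add: star_def)
        ultimately obtain w where "w \<in> e \<inter> star a" "w \<noteq> v"
          using no1 by (metis is_singletonI' is_singleton_altdef empty_iff)
        then show "\<exists>w\<in>e \<inter> V. w \<noteq> v \<and> a \<in> w"
          by (auto simp: star_def)
      next
        show "\<exists>a b. v = {a, b}" if "v \<in> V" for v
          using that links_pair by (simp add: V_def)
      next
        fix a b c d assume "{a, b} \<in> V" "{b, c} \<in> V" "{c, d} \<in> V" "{d, a} \<in> V" "distinct [a, b, c, d]"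
        then show False
          unfolding V_def by (rule links_no_square[OF k])
      next
        fix a b c assume "{a} \<in> V" "{a, b} \<in> V" "{b, c} \<in> V" "{c, a} \<in> V" "distinct [a, b, c]"
        then show False
          unfolding V_def by (rule links_no_triangle[OF k])
      next
        fix a b c assume "{b} \<in> V" "{c} \<in> V" "{a, b} \<in> V" "{a, c} \<in> V" "a \<noteq> b" "a \<noteq> c"
        then show "b = c"
          unfolding V_def by (rule links_far)
      qed (use fin in simp_all)
      moreover have "card e = card (e \<inter> V) + card (e \<inter> Q)"
      proof -
        have "e = (e \<inter> V) \<union> (e \<inter> Q)" "(e \<inter> V) \<inter> (e \<inter> Q) = {}"
          using e(1) disj by blast+
        then show ?thesis
          using fin card_Un_disjoint[of "e \<inter> V" "e \<inter> Q"] by simp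
      qed
      ultimately have "card (e \<inter> Q) = 1"
        using e(2) by simp
      then show False
        using no1[of Q] by (simp add: F_def)
    qed
  qed
  also have "card F \<le> Suc (card (star ` ({0..<k} \<times> {..<6})))"
    by (simp add: F_def card_insert_if)
  also have "\<dots> \<le> 6 * K + 1"
    using card_image_le[of "{0..<k} \<times> {..<6::nat}" star] by (simp add: card_cartesian_product K)
  finally show ?thesis .
qed

theorem theorem2p2:
  fixes n :: nat
  assumes "n \<ge> 100"
  shows "real (wsat4_B4 n) \<ge> 6 / 13 * real n - 11 / 13
         \<and> (n mod 13 = 4 \<longrightarrow> real (wsat4_B4 n) = (6 * real n - 11) / 13)"
proof -
  \<comment> \<open>The complete hypergraph is semi-saturated, so the minimum is attained.\<close>
  have "B4_semisat n {e. e \<subseteq> {..<n} \<and> card e = 4}"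
    by (auto simp: B4_semisat_def uniform4_def)
  then have "\<exists>k E. B4_semisat n E \<and> card E = k"
    by blast
  from LeastI_ex[OF this] obtain E where E: "B4_semisat n E" "card E = wsat4_B4 n"
    unfolding wsat4_B4_def by blast
  interpret semisaturated n E
    by unfold_locales (fact E(1))
  have lower: "6 * real n - 11 \<le> 13 * real (wsat4_B4 n)"
    using edges_lower_bound[OF assms] E(2) by simp
  have "real (wsat4_B4 n) = (6 * real n - 11) / 13" if "n mod 13 = 4"
  proof -
    define K where "K = n div 13"
    have n: "n = 13 * K + 4"
      using that div_mult_mod_eq[of n 13] by (simp add: K_def)
    \<comment> \<open>Here \<open>n \<ge> 100\<close> forces \<open>K \<ge> 8\<close>, and
      \<open>(6 * n - 11) / 13\<close> equals \<open>6 * K + 1\<close>.\<close>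
    with assms have "wsat4_B4 n \<le> 6 * K + 1"
      using wsat4_B4_le_6_13[of K] by simp
    then have "real (wsat4_B4 n) \<le> real (6 * K + 1)"
      by (rule of_nat_mono)
    with lower n show ?thesis
      by simp
  qed
  with lower show ?thesis
    by simp
qed

end
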